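(* Let $Q\in\mathbb{R}^{m\times n}$ have orthonormal columns, $m>n$, and define $P_Q=QQ^T$ and $P_Q^\perp=I-QQ^T$. Let $N\in\mathbb{R}^{m\times(m-n)}$ have orthonormal columns spanning $\operatorname{range}(P_Q^\perp)$, so that $NN^T=P_Q^\perp$. Let $X\in\operatorname{range}(P_Q^\perp)$ be a fixed vector, let $\sigma>0$, and let $Y\sim N(0,\sigma^2I_m)$. Then $$N^TY\sim N(0,\sigma^2I_{m-n}),$$ and for every $\varepsilon\ge0$, $$\mathbb P(\|X+P_Q^\perp Y\|_2>\varepsilon)=\mathcal Q_{(m-n)/2}^{ma}\left(\frac{\|X\|_2}{\sigma},\frac{\varepsilon}{\sigma}\right).$$
   Context: $N(0,\sigma^2I_d)$ is the centered Gaussian distribution on $\mathbb{R}^d$ with covariance $\sigma^2I_d$. For real $\nu$, the modified Bessel function of the first kind of order $\nu$ is $\mathcal I_\nu(t)=\sum_{j\ge0}\frac{(t/2)^{2j+\nu}}{j!\,\Gamma(\nu+j+1)}$. The generalized Marcum-Q function is defined, for $\beta\ge0$ and $\alpha,M>0$, by $$\mathcal Q_M^{ma}(\alpha,\beta)=\frac{1}{\alpha^{M-1}}\int_\beta^\infty x^M\exp\left(-\frac{x^2+\alpha^2}{2}\right)\mathcal I_{M-1}(\alpha x)\,dx,$$ and for $\alpha=0$ by $\mathcal Q_M^{ma}(0,\beta)=\Gamma(M,\beta^2/2)/\Gamma(M)$, where $\Gamma(s,t)=\int_t^\infty u^{s-1}e^{-u}\,du$ is the upper incomplete gamma function. *)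

theory Defs
  imports "HOL-Probability.Probability"
begin

text \<open>The type of the argument determines the dimension: on \<open>real ^ 'd\<close>, \<open>DIM(real ^ 'd)\<close> is
  \<open>CARD('d)\<close>, and this is the density of \<open>N(0, \<sigma>\<^sup>2 I\<^sub>d)\<close> for \<open>\<sigma> > 0\<close>.\<close>

definition iso_gaussian_density :: "real \<Rightarrow> 'a::euclidean_space \<Rightarrow> real" where
  "iso_gaussian_density \<sigma> x =
     exp (- (norm x)\<^sup>2 / (2 * \<sigma>\<^sup>2)) / (sqrt (2 * pi * \<sigma>\<^sup>2)) ^ DIM('a)"

definition orthonormal_columns :: "real ^ 'n ^ 'm \<Rightarrow> bool" where
  "orthonormal_columns A \<longleftrightarrow>
     (\<forall>i j. column i A \<bullet> column j A = (if i = j then 1 else 0))"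

definition col_proj :: "real ^ 'n ^ 'm \<Rightarrow> real ^ 'm ^ 'm" where
  "col_proj Q = Q ** transpose Q"

definition col_proj_perp :: "real ^ 'n ^ 'm \<Rightarrow> real ^ 'm ^ 'm" where
  "col_proj_perp Q = mat 1 - col_proj Q"

text \<open>Meant for \<open>t \<ge> 0\<close>. Since \<open>0 powr 0 = 0\<close> in HOL, the convention \<open>0\<^sup>0 = 1\<close> is restored
  explicitly, so that the value at \<open>\<nu> = 0\<close>, \<open>t = 0\<close> is \<open>1\<close>. At the poles of \<open>Gamma\<close> the quotient
  is \<open>0\<close>, in agreement with \<open>1 / Gamma\<close> as an entire function.\<close>

definition bessel_I :: "real \<Rightarrow> real \<Rightarrow> real" where
  "bessel_I \<nu> t =
     (\<Sum>j. (if t = 0 \<and> 2 * real j + \<nu> = 0 then 1 else (t / 2) powr (2 * real j + \<nu>)) /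
           (fact j * Gamma (\<nu> + real j + 1)))"

definition upper_Gamma :: "real \<Rightarrow> real \<Rightarrow> real" where
  "upper_Gamma s t = (LINT u:{t..}|lborel. u powr (s - 1) * exp (- u))"

text \<open>The arguments are the order \<open>k > 0\<close>, then \<open>\<alpha> \<ge> 0\<close> and \<open>\<beta> \<ge> 0\<close>.\<close>

definition marcum_Q :: "real \<Rightarrow> real \<Rightarrow> real \<Rightarrow> real" where
  "marcum_Q k \<alpha> \<beta> =
     (if \<alpha> = 0 then upper_Gamma k (\<beta>\<^sup>2 / 2) / Gamma k
      else 1 / \<alpha> powr (k - 1) *
        (LINT x:{\<beta>..}|lborel.
           x powr k * exp (- (x\<^sup>2 + \<alpha>\<^sup>2) / 2) * bessel_I (k - 1) (\<alpha> * x)))"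

end

theory Submission imports Defs begin

text \<open>Since \<open>x \<mapsto> (N\<^sup>T x, Q\<^sup>T x)\<close> is an isometry, it preserves Lebesgue measure, and
  \<open>N\<^sup>T Y\<close> is a marginal of a product Gaussian density. Writing \<open>X = N x\<close>, the norm in question is
  that of \<open>x + N\<^sup>T Y\<close>, a shifted Gaussian vector in dimension \<open>k = m - n\<close>. After scaling to variance
  one, with \<open>a = x / \<sigma>\<close>, its density is \<open>exp (-\<bar>a\<bar>\<^sup>2 / 2)\<close> times the standard one times
  \<open>exp (a \<bullet> y)\<close>, and by symmetry the last factor may be replaced by
  \<open>cosh (a \<bullet> y) = \<Sum>\<^sub>j (a \<bullet> y)\<^bsup>2j\<^esup> / (2j)!\<close>. As \<open>(a \<bullet> y)\<^bsup>2j\<^esup>\<close> is homogeneous,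
  its Gaussian integral over \<open>\<bar>y\<bar> > r\<close> is a constant times the tail integral of
  \<open>t\<^bsup>2j+k-1\<^esup> exp (-t\<^sup>2 / 2)\<close>; the constant is found at \<open>r = 0\<close> from the even moments of the normal
  distribution. Exchanging sum and integral turns the series into the Bessel series.\<close>

subsection \<open>Isometries and Gaussian densities\<close>

lemma nn_integral_lborel_translate:
  fixes g :: "'a::euclidean_space \<Rightarrow> ennreal"
  assumes [measurable]: "g \<in> borel_measurable borel"
  shows "(\<integral>\<^sup>+x. g (x + c) \<partial>lborel) = (\<integral>\<^sup>+x. g x \<partial>lborel)"
proof -
  have "(\<integral>\<^sup>+x. g x \<partial>lborel) = (\<integral>\<^sup>+x. g x \<partial>distr lborel borel ((+) c))"
    by (simp add: lborel_distr_plus)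
  also have "\<dots> = (\<integral>\<^sup>+x. g (x + c) \<partial>lborel)"
    by (subst nn_integral_distr) (simp_all add: add.commute)
  finally show ?thesis ..
qed

text \<open>Uniqueness of Haar measure: the image measure is translation invariant, so Fubini applied to
  the indicators of a unit ball and of an arbitrary set \<open>A\<close> compares the two measures of \<open>A\<close>; the unit
  balls of both spaces have the same volume.\<close>

lemma distr_lborel_isometry:
  fixes f :: "'a::euclidean_space \<Rightarrow> 'b::euclidean_space"
  assumes lin: "linear f" and norm_f: "\<And>x. norm (f x) = norm x" and surj: "surj f"
  shows "distr lborel borel f = lborel"
proof (rule measure_eqI)
  fix A assume "A \<in> sets (distr lborel borel f)"
  then have [measurable]: "A \<in> sets borel" by simp
  have [measurable]: "f \<in> borel_measurable borel"
    using lin by (intro borel_measurable_continuous_onI linear_continuous_on)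
      (simp add: linear_conv_bounded_linear [symmetric])
  have "inj f"
    using lin norm_f by (metis linear_injective_0 norm_eq_zero)
  then have "dim (f ` UNIV) = dim (UNIV :: 'a set)"
    using lin by (intro dim_image_eq) (auto simp: inj_on_def)
  then have dim: "DIM('b) = DIM('a)"
    using surj by simp
  let ?B = "ball 0 1 :: 'b set"
  have [measurable]: "?B \<in> sets borel" by simp
  define v where "v = emeasure lborel ?B"
  have v: "0 < v" "v < \<infinity>"
    by (auto simp: v_def emeasure_ball unit_ball_vol_pos emeasure_bounded_finite)
  have vol_a: "emeasure lborel (ball 0 1 :: 'a set) = v"
    by (simp add: v_def emeasure_ball dim)
  have vol_t: "emeasure lborel (ball c 1 :: 'b set) = v" for c
    by (simp add: v_def emeasure_ball)
  have "v * emeasure lborel A =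
      (\<integral>\<^sup>+x. indicator (ball 0 1) x * emeasure lborel A \<partial>(lborel :: 'a measure))"
    by (subst nn_integral_multc) (simp_all add: vol_a borel_measurable_indicator)
  also have "\<dots> = (\<integral>\<^sup>+x. (\<integral>\<^sup>+y. indicator ?B (f x) * indicator A y \<partial>lborel) \<partial>lborel)"
    by (intro nn_integral_cong) (simp add: nn_integral_cmult norm_f indicator_def [of "ball 0 1"])
  \<comment> \<open>Two translations move the shift from \<open>A\<close> to the ball: first y by
    \<open>f x\<close> for fixed x, then, after exchanging the integrals, x by a preimage of y for
    fixed y. Now \<open>A\<close> sees only \<open>f x\<close>, and integrating over y gives the
    volume of a unit ball centred at \<open>f x\<close>.\<close>
  also have "\<dots> = (\<integral>\<^sup>+x. (\<integral>\<^sup>+y. indicator ?B (f x) * indicator A (y + f x) \<partial>lborel) \<partial>lborel)"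
    by (intro nn_integral_cong nn_integral_lborel_translate [symmetric]) simp
  also have "\<dots> = (\<integral>\<^sup>+y. (\<integral>\<^sup>+x. indicator ?B (f x) * indicator A (y + f x) \<partial>lborel) \<partial>lborel)"
    by (rule lborel_pair.Fubini') measurable
  also have "\<dots> = (\<integral>\<^sup>+y. (\<integral>\<^sup>+x. indicator ?B (f x - y) * indicator A (f x) \<partial>lborel) \<partial>lborel)"
  proof (rule nn_integral_cong)
    fix y
    obtain y' where y: "y = f y'" using surj by blast
    have "(\<integral>\<^sup>+x. indicator ?B (f x - y) * indicator A (f x) \<partial>lborel) =
        (\<integral>\<^sup>+x. (indicator ?B (f (x + y') - y) * indicator A (f (x + y')) :: ennreal) \<partial>lborel)"
      by (rule nn_integral_lborel_translate [symmetric,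
          where g = "\<lambda>x. indicator ?B (f x - y) * indicator A (f x)"]) measurable
    then show "(\<integral>\<^sup>+x. indicator ?B (f x) * indicator A (y + f x) \<partial>lborel) =
        (\<integral>\<^sup>+x. (indicator ?B (f x - y) * indicator A (f x) :: ennreal) \<partial>lborel)"
      by (simp add: y linear_add [OF lin] add.commute)
  qed
  also have "\<dots> = (\<integral>\<^sup>+x. (\<integral>\<^sup>+y. indicator ?B (f x - y) * indicator A (f x) \<partial>lborel) \<partial>lborel)"
    by (rule lborel_pair.Fubini' [symmetric]) measurable
  also have "\<dots> = (\<integral>\<^sup>+x. v * indicator A (f x) \<partial>lborel)"
  proof (intro nn_integral_cong)
    fix x
    have "indicator ?B (f x - y) = (indicator (ball (f x) 1) y :: ennreal)" for y
      by (simp add: indicator_def dist_norm norm_minus_commute)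
    then show "(\<integral>\<^sup>+y. indicator ?B (f x - y) * indicator A (f x) \<partial>lborel) =
        v * indicator A (f x)"
      by (simp only:) (subst nn_integral_multc, simp_all add: vol_t borel_measurable_indicator)
  qed
  also have "\<dots> = v * emeasure (distr lborel borel f) A"
    by (subst nn_integral_indicator [symmetric], simp)
      (simp add: nn_integral_cmult nn_integral_distr del: nn_integral_indicator)
  finally show "emeasure (distr lborel borel f) A = emeasure lborel A"
    using v by (auto simp: ennreal_mult_cancel_left)
qed simp

section \<open>Isotropic Gaussian densities\<close>

lemma iso_gaussian_density_nonneg: "0 \<le> iso_gaussian_density \<sigma> x"
  by (simp add: iso_gaussian_density_def)

lemma measurable_iso_gaussian_density [measurable]:
  "iso_gaussian_density \<sigma> \<in> borel_measurable borel"
  unfolding iso_gaussian_density_def by measurable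

lemma iso_gaussian_density_prod:
  assumes "\<sigma> > 0"
  shows "iso_gaussian_density \<sigma> x = (\<Prod>b\<in>Basis. normal_density 0 \<sigma> (x \<bullet> b))"
proof -
  have "(norm x)\<^sup>2 = (\<Sum>b\<in>Basis. (x \<bullet> b)\<^sup>2)"
    unfolding power2_norm_eq_inner by (subst euclidean_inner) (simp add: power2_eq_square)
  then show ?thesis
    unfolding iso_gaussian_density_def normal_density_def
    by (simp add: prod.distrib prod_dividef exp_sum [symmetric] sum_divide_distrib sum_negf)
qed

lemma nn_integral_normal_density: "\<sigma> > 0 \<Longrightarrow> (\<integral>\<^sup>+x. normal_density \<mu> \<sigma> x \<partial>lborel) = 1"
  using prob_space.emeasure_space_1 [OF prob_space_normal_density, of \<sigma> \<mu>]
  by (simp add: emeasure_density)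

lemma nn_integral_iso_gaussian_density:
  assumes "\<sigma> > 0"
  shows "(\<integral>\<^sup>+x. iso_gaussian_density \<sigma> (x :: 'a::euclidean_space) \<partial>lborel) = 1"
proof -
  have "(\<integral>\<^sup>+x. iso_gaussian_density \<sigma> (x :: 'a) \<partial>lborel) =
      (\<integral>\<^sup>+x. (\<Prod>b\<in>(Basis :: 'a set). ennreal (normal_density 0 \<sigma> (x \<bullet> b))) \<partial>lborel)"
    using assms by (simp add: iso_gaussian_density_prod prod_ennreal)
  also have "\<dots> = 1"
    using assms by (subst nn_integral_lborel_prod) (simp_all add: nn_integral_normal_density)
  finally show ?thesis .
qed

text \<open>Squared norms and dimensions both add over a pair, so exponentials and normalising
  constants both multiply. Integrating out \<open>v\<close> then leaves the density in
  \<open>u\<close>, which is how the marginal is taken later.\<close>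

lemma iso_gaussian_density_Pair:
  "iso_gaussian_density \<sigma> (u, v) = iso_gaussian_density \<sigma> u * iso_gaussian_density \<sigma> v"
proof -
  have "- (norm (u, v))\<^sup>2 / (2 * \<sigma>\<^sup>2) = - (norm u)\<^sup>2 / (2 * \<sigma>\<^sup>2) + - (norm v)\<^sup>2 / (2 * \<sigma>\<^sup>2)"
    by (simp add: norm_Pair diff_divide_distrib)
  then show ?thesis
    by (simp only: iso_gaussian_density_def exp_add DIM_prod power_add times_divide_times_eq)
qed

section \<open>Matrices with orthonormal columns\<close>

lemma orthonormal_columns_iff:
  "orthonormal_columns A \<longleftrightarrow> transpose A ** A = mat 1"
  by (simp add: orthonormal_columns_def vec_eq_iff matrix_matrix_mult_def transpose_def mat_def
      column_def inner_vec_def)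

lemma orthonormal_columns_left_inverse:
  assumes "orthonormal_columns A"
  shows "transpose A *v (A *v x) = x"
  using assms by (simp add: orthonormal_columns_iff matrix_vector_mul_assoc)

lemma norm_orthonormal_columns:
  assumes "orthonormal_columns A"
  shows "norm (A *v x) = norm x"
proof -
  have "(A *v x) \<bullet> (A *v x) = x \<bullet> (transpose A *v (A *v x))"
    by (metis dot_lmul_matrix inner_commute vector_transpose_matrix transpose_matrix_vector)
  then show ?thesis
    using orthonormal_columns_left_inverse [OF assms, of x] by (simp add: norm_eq_sqrt_inner)
qed

lemma borel_measurable_matrix_vector_mult [measurable (raw)]:
  fixes A :: "real ^ 'n ^ 'm"
  assumes "f \<in> borel_measurable M"
  shows "(\<lambda>x. A *v f x) \<in> borel_measurable M"
proof -
  have "(*v) A \<in> borel_measurable borel"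
    by (intro borel_measurable_continuous_onI linear_continuous_on matrix_vector_mul_bounded_linear)
  from measurable_compose [OF assms this] show ?thesis .
qed

text \<open>The map \<open>h\<close> takes coordinates along the columns of \<open>N\<close> and
  \<open>Q\<close>, and \<open>f\<close> reassembles the vector. That \<open>f\<close> inverts
  \<open>h\<close> on one side is the identity \<open>NNT\<close>; the other side needs the two
  ranges to be orthogonal, which also follows from \<open>NNT\<close>.\<close>

lemma distributed_gaussian_orthonormal:
  fixes M :: "'w measure" and Q :: "real ^ 'n ^ 'm" and N :: "real ^ 'k ^ 'm"
    and Y :: "'w \<Rightarrow> real ^ 'm"
  assumes dim: "CARD('k) + CARD('n) = CARD('m)"
    and Q: "orthonormal_columns Q" and N: "orthonormal_columns N"
    and NNT: "N ** transpose N = col_proj_perp Q"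
    and \<sigma>: "\<sigma> > 0" and M: "prob_space M"
    and Y: "distributed M lborel Y (\<lambda>y. ennreal (iso_gaussian_density \<sigma> y))"
  shows "distributed M lborel (\<lambda>\<omega>. transpose N *v Y \<omega>)
           (\<lambda>z. ennreal (iso_gaussian_density \<sigma> z))"
proof -
  interpret prob_space M by fact
  define f where "f p = N *v fst p + Q *v snd p" for p
  define h where "h y = (transpose N *v y, transpose Q *v y)" for y
  have NN: "N *v (transpose N *v y) = y - Q *v (transpose Q *v y)" for y
    using NNT by (simp add: matrix_vector_mul_assoc col_proj_perp_def col_proj_def
        matrix_vector_mult_diff_rdistrib del: transpose_matrix_vector)
  have fh: "f (h y) = y" for y
    using NN by (simp add: f_def h_def del: transpose_matrix_vector)
  \<comment> \<open>\<open>N *v u\<close> is fixed by \<open>N ** transpose N\<close>, hence killed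
    by \<open>Q ** transpose Q\<close>. Since \<open>Q\<close> preserves norms,
    \<open>transpose Q\<close> alone already kills it.\<close>
  have QTN: "transpose Q *v (N *v u) = 0" for u
  proof -
    have "N *v u = N *v (transpose N *v (N *v u))"
      by (simp only: orthonormal_columns_left_inverse [OF N])
    also have "\<dots> = N *v u - Q *v (transpose Q *v (N *v u))"
      by (rule NN)
    finally have "Q *v (transpose Q *v (N *v u)) = 0" by simp
    then show ?thesis
      by (metis norm_eq_zero norm_orthonormal_columns [OF Q])
  qed
  have orth: "(N *v u) \<bullet> (Q *v v) = 0" for u v
  proof -
    have "(N *v u) \<bullet> (Q *v v) = (transpose Q *v (N *v u)) \<bullet> v"
      by (metis dot_lmul_matrix transpose_matrix_vector)
    then show ?thesis by (simp add: QTN del: transpose_matrix_vector)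
  qed
  \<comment> \<open>The squared norm of this vector is the inner product of an element of the range
    of \<open>N\<close> with \<open>Q *v v\<close>.\<close>
  have NTQ: "transpose N *v (Q *v v) = 0" for v
  proof -
    have "(transpose N *v (Q *v v)) \<bullet> (transpose N *v (Q *v v)) =
        (N *v (transpose N *v (Q *v v))) \<bullet> (Q *v v)"
      by (metis dot_lmul_matrix inner_commute transpose_matrix_vector)
    then show ?thesis by (simp add: orth del: transpose_matrix_vector)
  qed
  have hf: "h (f p) = p" for p
    using Q N
    by (simp add: h_def f_def matrix_vector_right_distrib orthonormal_columns_left_inverse QTN NTQ
        del: transpose_matrix_vector)
  have lin: "linear f"
    unfolding f_def by (rule linearI)
      (simp_all add: matrix_vector_right_distrib scaleR_matrix_vector_assoc
        matrix_vector_mult_scaleR scaleR_right_distrib)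
  have norm_f: "norm (f p) = norm p" for p
  proof -
    have "(norm (f p))\<^sup>2 = (norm (fst p))\<^sup>2 + (norm (snd p))\<^sup>2"
      using norm_add_Pythagorean [of "N *v fst p" "Q *v snd p"] orth Q N
      by (simp add: f_def orthogonal_def norm_orthonormal_columns)
    then show ?thesis by (simp add: norm_prod_def real_sqrt_unique)
  qed
  have [measurable]: "f \<in> borel_measurable borel" "h \<in> borel_measurable borel"
  proof -
    show "f \<in> borel_measurable borel"
      using lin by (intro borel_measurable_continuous_onI linear_continuous_on)
        (simp add: linear_conv_bounded_linear [symmetric])
    show "h \<in> borel_measurable borel"
      unfolding h_def borel_prod [symmetric] by measurable
  qed
  have distr_f: "distr lborel borel f = lborel"
    using lin norm_f surjI [of f h, OF fh] by (rule distr_lborel_isometry)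
  have norm_h: "norm (h y) = norm y" for y
    by (metis fh norm_f)
  \<comment> \<open>Invariance passes from \<open>f\<close> to its inverse: writing Lebesgue measure
    as an image under \<open>f\<close>, the map \<open>h\<close> undoes \<open>f\<close>.\<close>
  have distr_h: "distr lborel borel h = lborel"
  proof -
    have "distr lborel borel h = distr (distr lborel borel f) borel h"
      by (simp only: distr_f)
    also have "\<dots> = distr lborel borel (h \<circ> f)"
      by (subst distr_distr) simp_all
    finally show ?thesis
      by (simp add: comp_def hf distr_id2)
  qed
  \<comment> \<open>Equality of norms takes care of the exponent; the normalising constant needs the
    dimensions to agree, which is \<open>dim\<close>.\<close>
  have dens_h: "iso_gaussian_density \<sigma> (h y) = iso_gaussian_density \<sigma> y" for y
    using dim by (simp add: iso_gaussian_density_def norm_h)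
  have [measurable]: "Y \<in> borel_measurable M"
    using distributed_measurable [OF Y] by simp
  have "distr M borel (\<lambda>\<omega>. h (Y \<omega>)) = distr (distr M lborel Y) borel h"
    by (subst distr_distr) (simp_all add: comp_def)
  also have "distr M lborel Y = density lborel (\<lambda>y. ennreal (iso_gaussian_density \<sigma> (h y)))"
    using distributed_distr_eq_density [OF Y] by (simp add: dens_h)
  also have "distr \<dots> borel h = density lborel (\<lambda>p. ennreal (iso_gaussian_density \<sigma> p))"
    by (subst density_distr [symmetric]) (simp_all add: distr_h)
  finally have "distributed M lborel (\<lambda>\<omega>. h (Y \<omega>)) (\<lambda>p. ennreal (iso_gaussian_density \<sigma> p))"
    by (simp add: distributed_def cong: distr_cong)
  then have "distributed M (lborel \<Otimes>\<^sub>M lborel)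
      (\<lambda>\<omega>. (transpose N *v Y \<omega>, transpose Q *v Y \<omega>)) (\<lambda>p. ennreal (iso_gaussian_density \<sigma> p))"
    by (simp add: lborel_prod h_def)
  from distr_marginal1 [OF lborel.sigma_finite_measure_axioms lborel.sigma_finite_measure_axioms this]
  show ?thesis
    using \<sigma> by (simp add: iso_gaussian_density_Pair ennreal_mult iso_gaussian_density_nonneg
        nn_integral_cmult nn_integral_iso_gaussian_density)
qed

subsection \<open>Radial integration of homogeneous functions\<close>

text \<open>Half-lines form an intersection-stable generator, so the distribution function
  determines the measure, and differentiating \<open>c * r powr q\<close> gives the density. The
  lemma serves both for polar integration and for the substitution in the Gamma integral.\<close>

lemma measure_eqI_powr_density:
  fixes \<mu> :: "real measure"
  assumes sets: "sets \<mu> = sets borel" and c: "0 \<le> c" and q: "0 < q"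
    and le: "\<And>r. 0 \<le> r \<Longrightarrow> emeasure \<mu> {..r} = ennreal (c * r powr q)"
  shows "\<mu> = density lborel (\<lambda>x. ennreal (c * q * x powr (q - 1)) * indicator {0..} x)" (is "_ = ?\<nu>")
proof (rule measure_eqI_generator_eq [where E = "range (\<lambda>r. {..r})" and A = "\<lambda>i. {..real i}" and \<Omega> = UNIV])
  show "Int_stable (range (\<lambda>r::real. {..r}))"
    by (auto simp: Int_stable_def)
  show "sets \<mu> = sigma_sets UNIV (range (\<lambda>r. {..r}))" "sets ?\<nu> = sigma_sets UNIV (range (\<lambda>r. {..r}))"
    by (simp_all add: sets borel_eq_atMost)
  show "(\<Union>i. {..real i}) = UNIV"
    by (auto intro: real_arch_simple)
  show "emeasure \<mu> {..real i} \<noteq> \<infinity>" for i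
    by (simp add: le)
  fix X assume "X \<in> range (\<lambda>r::real. {..r})"
  then obtain r where X: "X = {..r}" by blast
  show "emeasure \<mu> X = emeasure ?\<nu> X"
  proof (cases "r < 0")
    case True
    \<comment> \<open>The hypothesis at 0 reads \<open>c * 0 powr q = 0\<close>, so the negative
      half-line carries no mass.\<close>
    have "emeasure \<mu> {..r} \<le> emeasure \<mu> {..0}"
      using True by (intro emeasure_mono) (auto simp: sets)
    then have "emeasure \<mu> X = 0"
      by (simp add: X le)
    moreover have "emeasure ?\<nu> X = (\<integral>\<^sup>+x. 0 \<partial>(lborel :: real measure))"
      unfolding X using True
      by (subst emeasure_density, simp, simp, intro nn_integral_cong) (simp add: indicator_def)
    ultimately show ?thesis by simp
  next
    case False
    have "((\<lambda>x. c * q * x powr (q - 1)) has_integral (c * q * (r powr q / q))) {0..r}"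
      using has_integral_powr_from_0 [of "q - 1" r] q False by (intro has_integral_mult_right) simp
    then have "(\<integral>\<^sup>+x. ennreal (c * q * x powr (q - 1)) * indicator {0..r} x \<partial>lborel) = ennreal (c * r powr q)"
      using q c by (subst nn_integral_has_integral_lebesgue') auto
    moreover have "emeasure ?\<nu> X =
        (\<integral>\<^sup>+x. ennreal (c * q * x powr (q - 1)) * indicator {0..r} x \<partial>lborel)"
      by (subst emeasure_density) (auto simp: X indicator_def intro!: nn_integral_cong)
    ultimately show ?thesis
      using False by (simp add: X le)
  qed
qed auto

text \<open>Under x = r y, homogeneity contributes r to the power \<open>p\<close> and the Jacobian
  contributes r to the power of the dimension.\<close>

lemma emeasure_homogeneous_cball:
  fixes h :: "'a::euclidean_space \<Rightarrow> real"
  assumes h [measurable]: "h \<in> borel_measurable borel" and nonneg: "\<And>x. 0 \<le> h x"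
    and hom: "\<And>t x. 0 < t \<Longrightarrow> h (t *\<^sub>R x) = t ^ p * h x" and r: "0 < r"
  shows "(\<integral>\<^sup>+x. ennreal (h x) * indicator (cball 0 r) x \<partial>lborel) =
    (\<integral>\<^sup>+x. ennreal (h x) * indicator (cball 0 1) x \<partial>lborel) * ennreal (r ^ (p + DIM('a)))"
proof -
  have [measurable]: "cball 0 t \<in> sets (borel :: 'a measure)" for t by simp
  have "(\<integral>\<^sup>+x. ennreal (h x) * indicator (cball 0 r) x \<partial>lborel) =
     (\<integral>\<^sup>+x. ennreal (h x) * indicator (cball 0 r) x
        \<partial>density (distr lborel borel (\<lambda>x::'a. 0 + r *\<^sub>R x)) (\<lambda>_. \<bar>r\<bar> ^ DIM('a)))"
    using r by (subst lborel_affine [of r 0]) simp_all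
  also have "\<dots> = (\<integral>\<^sup>+x. ennreal (r ^ DIM('a)) * (ennreal (h (r *\<^sub>R x)) * indicator (cball 0 r) (r *\<^sub>R x)) \<partial>lborel)"
    using r by (simp add: nn_integral_density nn_integral_distr)
  also have "\<dots> = (\<integral>\<^sup>+x. (ennreal (h x) * indicator (cball 0 1) x) * ennreal (r ^ (p + DIM('a))) \<partial>lborel)"
    using r nonneg by (intro nn_integral_cong)
      (auto simp: hom indicator_def power_add ennreal_mult mult_ac)
  also have "\<dots> = (\<integral>\<^sup>+x. ennreal (h x) * indicator (cball 0 1) x \<partial>lborel) * ennreal (r ^ (p + DIM('a)))"
    by (rule nn_integral_multc) measurable
  finally show ?thesis .
qed

text \<open>The measure with density \<open>h\<close>, pushed forward by the norm, has a pure power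
  as distribution function, hence a power density. The constant is only asserted to exist,
  independently of the radial factor; it is determined later from one known integral.\<close>

lemma nn_integral_homogeneous_radial:
  fixes h :: "'a::euclidean_space \<Rightarrow> real"
  assumes h [measurable]: "h \<in> borel_measurable borel" and nonneg: "\<And>x. 0 \<le> h x"
    and hom: "\<And>t x. 0 < t \<Longrightarrow> h (t *\<^sub>R x) = t ^ p * h x"
    and bound: "\<And>x. norm x \<le> 1 \<Longrightarrow> h x \<le> B"
  obtains C where "0 \<le> C" and
    "\<And>\<phi>. \<phi> \<in> borel_measurable borel \<Longrightarrow> (\<integral>\<^sup>+x. ennreal (h x) * \<phi> (norm x) \<partial>lborel) =
       ennreal C * (\<integral>\<^sup>+x. ennreal (x powr (real (p + DIM('a)) - 1)) * indicator {0..} x * \<phi> x \<partial>lborel)"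
proof -
  let ?q = "real (p + DIM('a))"
  let ?\<mu> = "distr (density lborel (\<lambda>x. ennreal (h x))) borel norm"
  define I where "I = (\<integral>\<^sup>+x. ennreal (h x) * indicator (cball (0 :: 'a) 1) x \<partial>lborel)"
  \<comment> \<open>The bound on the unit ball makes the constant finite, so that it can be taken as
    a real number.\<close>
  have "I \<le> (\<integral>\<^sup>+x. ennreal B * indicator (cball (0 :: 'a) 1) x \<partial>lborel)"
    unfolding I_def using bound by (intro nn_integral_mono) (auto simp: indicator_def intro: ennreal_leI)
  also have "\<dots> < \<infinity>"
    using emeasure_bounded_finite [of "cball (0 :: 'a) 1"]
    by (simp add: nn_integral_cmult_indicator ennreal_mult_less_top)
  finally obtain c where c: "0 \<le> c" "I = ennreal c"
    by (cases I) auto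
  have q: "0 < ?q" using DIM_positive [where 'a = 'a] by (simp del: DIM_positive)
  have "?\<mu> = density lborel (\<lambda>x. ennreal (c * ?q * x powr (?q - 1)) * indicator {0..} x)"
  proof (rule measure_eqI_powr_density [OF _ c(1) q])
    fix r :: real assume "0 \<le> r"
    have "emeasure ?\<mu> {..r} = (\<integral>\<^sup>+x. ennreal (h x) * indicator (cball 0 r) x \<partial>lborel)"
    proof -
      have "norm -` {..r} = cball (0 :: 'a) r" by auto
      then show ?thesis by (simp add: emeasure_distr emeasure_density)
    qed
    also have "\<dots> = ennreal (c * r powr ?q)"
    \<comment> \<open>Scaling needs a positive radius; the ball of radius 0 is a single point and so
      a null set.\<close>
    proof (cases "r = 0")
      case True
      have "AE x in lborel. ennreal (h x) * indicator (cball 0 0) x = 0"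
        using AE_lborel_singleton [of "0 :: 'a"] by eventually_elim auto
      then show ?thesis
        using True by (simp add: nn_integral_0_iff_AE cong: nn_integral_cong_AE)
    next
      case False
      with \<open>0 \<le> r\<close> have "0 < r" by simp
      with c show ?thesis
        by (subst emeasure_homogeneous_cball [OF h nonneg hom])
          (simp_all only: I_def [symmetric] powr_realpow ennreal_mult zero_le_power less_imp_le)
    qed
    finally show "emeasure ?\<mu> {..r} = ennreal (c * r powr ?q)" .
  qed simp
  note \<mu> = this
  show ?thesis
  proof (rule that [of "c * ?q"])
    show "0 \<le> c * ?q" using c by simp
    fix \<phi> :: "real \<Rightarrow> ennreal" assume [measurable]: "\<phi> \<in> borel_measurable borel"
    have "(\<integral>\<^sup>+x. ennreal (h x) * \<phi> (norm x) \<partial>lborel) = (\<integral>\<^sup>+x. \<phi> x \<partial>?\<mu>)"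
      by (subst nn_integral_distr, simp, simp, subst nn_integral_density) simp_all
    also have "\<dots> = (\<integral>\<^sup>+x. ennreal (c * ?q * x powr (?q - 1)) * indicator {0..} x * \<phi> x \<partial>lborel)"
      unfolding \<mu> by (subst nn_integral_density) simp_all
    also have "\<dots> = (\<integral>\<^sup>+x. ennreal (c * ?q) * (ennreal (x powr (?q - 1)) * indicator {0..} x * \<phi> x) \<partial>lborel)"
      using c by (intro nn_integral_cong) (simp add: ennreal_mult mult_ac)
    also have "\<dots> = ennreal (c * ?q) * (\<integral>\<^sup>+x. ennreal (x powr (?q - 1)) * indicator {0..} x * \<phi> x \<partial>lborel)"
      by (rule nn_integral_cmult) measurable
    finally show "(\<integral>\<^sup>+x. ennreal (h x) * \<phi> (norm x) \<partial>lborel) =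
       ennreal (c * ?q) * (\<integral>\<^sup>+x. ennreal (x powr (?q - 1)) * indicator {0..} x * \<phi> x \<partial>lborel)" .
  qed
qed

text \<open>This is the substitution x = sqrt (2 u), carried out by computing the distribution
  function of the image measure, so that it holds for every nonnegative measurable
  \<open>\<psi>\<close>.\<close>

lemma nn_integral_powr_sqrt:
  assumes s: "0 < s" and [measurable]: "\<psi> \<in> borel_measurable borel"
  shows "(\<integral>\<^sup>+u. ennreal (u powr (s - 1)) * indicator {0..} u * \<psi> (sqrt (2 * u)) \<partial>lborel) =
    ennreal (2 powr (1 - s)) *
      (\<integral>\<^sup>+x. ennreal (x powr (2 * s - 1)) * indicator {0..} x * \<psi> x \<partial>lborel)"
proof -
  let ?w = "\<lambda>u. ennreal (u powr (s - 1)) * indicator {0..} u"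
  let ?\<mu> = "distr (density lborel ?w) borel (\<lambda>u. sqrt (2 * u))"
  \<comment> \<open>Here q = 2 s, and the constant comes from the integral of
    \<open>u powr (s - 1)\<close> up to \<open>r\<^sup>2 / 2\<close>, which is
    \<open>(r\<^sup>2 / 2) powr s / s\<close>.\<close>
  have "?\<mu> = density lborel (\<lambda>x. ennreal (2 powr (- s) / s * (2 * s) * x powr (2 * s - 1)) * indicator {0..} x)"
  proof (rule measure_eqI_powr_density)
    fix r :: real assume r: "0 \<le> r"
    have "emeasure ?\<mu> {..r} = (\<integral>\<^sup>+u. ennreal (u powr (s - 1)) * indicator {0..r\<^sup>2 / 2} u \<partial>lborel)"
    proof -
      have "sqrt (2 * u) \<le> r \<longleftrightarrow> u \<le> r\<^sup>2 / 2" for u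
        using real_sqrt_le_iff [of "2 * u" "r\<^sup>2"] r by (simp add: mult.commute)
      then have "(\<lambda>u. sqrt (2 * u)) -` {..r} = {..r\<^sup>2 / 2}" by auto
      then show ?thesis
        by (simp add: emeasure_distr emeasure_density)
          (intro nn_integral_cong, simp add: indicator_def)
    qed
    also have "\<dots> = ennreal ((r\<^sup>2 / 2) powr s / s)"
      using has_integral_powr_from_0 [of "s - 1" "r\<^sup>2 / 2"] s
      by (subst nn_integral_has_integral_lebesgue') auto
    also have "(r\<^sup>2 / 2) powr s / s = 2 powr (- s) / s * r powr (2 * s)"
    proof -
      have "(r\<^sup>2 / 2) powr s = r powr (2 * s) / 2 powr s"
        using r by (cases "r = 0") (simp_all add: powr_divide powr_powr [symmetric])
      then show ?thesis by (simp add: powr_minus_divide)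
    qed
    finally show "emeasure ?\<mu> {..r} = ennreal (2 powr (- s) / s * r powr (2 * s))" .
  qed (use s in auto)
  also have "2 powr (- s) / s * (2 * s) = 2 powr (1 - s)"
    using s by (simp add: powr_diff powr_minus divide_simps)
  finally have \<mu>: "?\<mu> = density lborel (\<lambda>x. ennreal (2 powr (1 - s) * x powr (2 * s - 1)) * indicator {0..} x)" .
  have "(\<integral>\<^sup>+u. ?w u * \<psi> (sqrt (2 * u)) \<partial>lborel) = (\<integral>\<^sup>+x. \<psi> x \<partial>?\<mu>)"
    by (subst nn_integral_distr, simp, simp, subst nn_integral_density) simp_all
  also have "\<dots> = (\<integral>\<^sup>+x. ennreal (2 powr (1 - s) * x powr (2 * s - 1)) * indicator {0..} x * \<psi> x \<partial>lborel)"
    unfolding \<mu> by (subst nn_integral_density) simp_all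
  also have "\<dots> = (\<integral>\<^sup>+x. ennreal (2 powr (1 - s)) *
      (ennreal (x powr (2 * s - 1)) * indicator {0..} x * \<psi> x) \<partial>lborel)"
    by (intro nn_integral_cong) (simp add: ennreal_mult mult_ac)
  also have "\<dots> = ennreal (2 powr (1 - s)) *
      (\<integral>\<^sup>+x. ennreal (x powr (2 * s - 1)) * indicator {0..} x * \<psi> x \<partial>lborel)"
    by (rule nn_integral_cmult) measurable
  finally show ?thesis .
qed

subsection \<open>Tails of Gaussian moments\<close>

lemma cosh_sums: "(\<lambda>j. x ^ (2 * j) / fact (2 * j)) sums cosh (x :: real)"
proof -
  have "(\<lambda>j. (\<lambda>n. if even n then x ^ n /\<^sub>R fact n else 0) (2 * j)) sums cosh x"
    by (subst sums_mono_reindex) (auto simp: strict_mono_def cosh_converges elim!: evenE)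
  then show ?thesis by (simp add: divide_inverse mult.commute)
qed

text \<open>The integrand is a product over coordinates: the coordinate along \<open>b\<close> gives
  the even moment of a standard normal variable, and every other coordinate integrates to 1.\<close>

lemma nn_integral_gaussian_coord_moment:
  assumes b: "b \<in> Basis"
  shows "(\<integral>\<^sup>+x. ennreal (iso_gaussian_density 1 x * (x \<bullet> b) ^ (2 * j)) \<partial>lborel) =
     ennreal (fact (2 * j) / (2 ^ j * fact j))"
proof -
  define f where "f c t = ennreal (std_normal_density t * (if c = b then t ^ (2 * j) else 1))" for c t
  have moment: "(\<integral>\<^sup>+t. f c t \<partial>lborel) = (if c = b then ennreal (fact (2 * j) / (2 ^ j * fact j)) else 1)" for c
  proof (cases "c = b")
    case True
    have "(\<integral>\<^sup>+t. f c t \<partial>lborel) = ennreal (\<integral>t. std_normal_density t * t ^ (2 * j) \<partial>lborel)"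
      unfolding f_def using True std_normal_moment_even [of j]
      by (subst nn_integral_eq_integral) (auto simp: has_bochner_integral_iff)
    then show ?thesis
      using True by (simp add: integral_std_normal_moment_even)
  qed (simp add: f_def nn_integral_normal_density)
  have "(\<integral>\<^sup>+x. ennreal (iso_gaussian_density 1 x * (x \<bullet> b) ^ (2 * j)) \<partial>lborel) =
      (\<integral>\<^sup>+x. (\<Prod>c\<in>Basis. f c (x \<bullet> c)) \<partial>lborel)"
  proof (intro nn_integral_cong)
    fix x :: 'a
    have "(x \<bullet> b) ^ (2 * j) = (\<Prod>c\<in>Basis. if c = b then (x \<bullet> c) ^ (2 * j) else 1)"
      using b by simp
    then show "ennreal (iso_gaussian_density 1 x * (x \<bullet> b) ^ (2 * j)) = (\<Prod>c\<in>Basis. f c (x \<bullet> c))"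
      by (simp add: f_def prod_ennreal prod.distrib iso_gaussian_density_prod)
  qed
  also have "\<dots> = (\<Prod>c\<in>Basis. \<integral>\<^sup>+t. f c t \<partial>lborel)"
    by (rule nn_integral_lborel_prod) (simp_all add: f_def)
  also have "\<dots> = ennreal (fact (2 * j) / (2 ^ j * fact j))"
    using b by (simp add: moment)
  finally show ?thesis .
qed

text \<open>A rotation taking \<open>a\<close> to \<open>norm a *\<^sub>R b\<close> for a basis
  vector \<open>b\<close> preserves both the density and Lebesgue measure, which reduces the claim
  to a coordinate moment.\<close>

lemma nn_integral_gaussian_inner_moment:
  fixes a :: "real ^ 'k"
  shows "(\<integral>\<^sup>+x. ennreal (iso_gaussian_density 1 x * (a \<bullet> x) ^ (2 * j)) \<partial>lborel) =
     ennreal (norm a ^ (2 * j) * (fact (2 * j) / (2 ^ j * fact j)))"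
proof -
  obtain b :: "real ^ 'k" where b: "b \<in> Basis"
    using nonempty_Basis by blast
  then obtain f where f: "orthogonal_transformation f" "f a = norm a *\<^sub>R b"
    using orthogonal_transformation_exists [of a "norm a *\<^sub>R b"] by auto
  have lin: "linear f" and norm_f: "norm (f x) = norm x" for x
    using f(1) by (auto simp: orthogonal_transformation)
  have inner_f: "f x \<bullet> f y = x \<bullet> y" for x y
    using f(1) by (simp add: orthogonal_transformation_def)
  have [measurable]: "f \<in> borel_measurable borel"
    using lin by (intro borel_measurable_continuous_onI linear_continuous_on)
      (simp add: linear_conv_bounded_linear [symmetric])
  have "(\<integral>\<^sup>+x. ennreal (iso_gaussian_density 1 x * (a \<bullet> x) ^ (2 * j)) \<partial>lborel) =
      (\<integral>\<^sup>+x. ennreal (iso_gaussian_density 1 (f x) * (norm a * (f x \<bullet> b)) ^ (2 * j)) \<partial>lborel)"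
  proof (intro nn_integral_cong)
    fix x
    have "a \<bullet> x = norm a * (f x \<bullet> b)"
      using inner_f [of a x] f(2) by (simp add: inner_commute)
    then show "ennreal (iso_gaussian_density 1 x * (a \<bullet> x) ^ (2 * j)) =
        ennreal (iso_gaussian_density 1 (f x) * (norm a * (f x \<bullet> b)) ^ (2 * j))"
      by (simp add: iso_gaussian_density_def norm_f)
  qed
  also have "\<dots> = (\<integral>\<^sup>+x. ennreal (iso_gaussian_density 1 x * (norm a * (x \<bullet> b)) ^ (2 * j))
      \<partial>distr lborel borel f)"
    by (subst nn_integral_distr) simp_all
  also have "distr lborel borel f = lborel"
    using lin norm_f orthogonal_transformation_surj [OF f(1)] by (rule distr_lborel_isometry)
  also have "(\<integral>\<^sup>+x. ennreal (iso_gaussian_density 1 x * (norm a * (x \<bullet> b)) ^ (2 * j)) \<partial>lborel) =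
      (\<integral>\<^sup>+x. ennreal (norm a ^ (2 * j)) * ennreal (iso_gaussian_density 1 x * (x \<bullet> b) ^ (2 * j)) \<partial>lborel)"
    by (intro nn_integral_cong)
      (simp add: ennreal_mult [symmetric] iso_gaussian_density_nonneg power_mult_distrib
        mult.left_commute)
  also have "\<dots> = ennreal (norm a ^ (2 * j)) * ennreal (fact (2 * j) / (2 ^ j * fact j))"
    using b by (simp add: nn_integral_cmult nn_integral_gaussian_coord_moment)
  finally show ?thesis
    by (simp add: ennreal_mult [symmetric])
qed

text \<open>Up to the factor \<open>2 powr (s - 1)\<close> this is the upper incomplete Gamma
  function at \<open>r\<^sup>2 / 2\<close>. The integrand is split into the power weight on the
  half-line and a remaining factor so as to match the radial formula and the substitution; the
  strict bound matches the event that the norm exceeds r.\<close>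

definition gauss_powr_tail :: "real \<Rightarrow> real \<Rightarrow> ennreal" where
  "gauss_powr_tail s r =
     (\<integral>\<^sup>+x. ennreal (x powr (2 * s - 1)) * indicator {0..} x *
        ennreal (exp (- x\<^sup>2 / 2) * indicator {r<..} x) \<partial>lborel)"

lemma gauss_powr_tail_eq_upper_Gamma:
  assumes s: "0 < s" and r: "0 \<le> r"
  shows "(\<integral>\<^sup>+u. ennreal (u powr (s - 1) * exp (- u)) * indicator {r\<^sup>2 / 2..} u \<partial>lborel) =
    ennreal (2 powr (1 - s)) * gauss_powr_tail s r"
proof -
  \<comment> \<open>The incomplete Gamma integral includes its endpoint and the tail excludes it;
    the two integrands agree off this point.\<close>
  have "AE u in lborel. u \<noteq> r\<^sup>2 / 2" by (rule AE_lborel_singleton)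
  then have "(\<integral>\<^sup>+u. ennreal (u powr (s - 1) * exp (- u)) * indicator {r\<^sup>2 / 2..} u \<partial>lborel) =
    (\<integral>\<^sup>+u. ennreal (u powr (s - 1)) * indicator {0..} u *
        ennreal (exp (- (sqrt (2 * u))\<^sup>2 / 2) * indicator {r<..} (sqrt (2 * u))) \<partial>lborel)"
  proof (intro nn_integral_cong_AE, eventually_elim)
    case (elim u)
    have "r < sqrt (2 * u) \<longleftrightarrow> r\<^sup>2 / 2 < u"
      using real_sqrt_less_iff [of "r\<^sup>2" "2 * u"] r by (simp add: field_simps)
    moreover have "0 \<le> u" if "r\<^sup>2 / 2 \<le> u"
      using that by (meson order_trans zero_le_power2 divide_nonneg_nonneg zero_le_numeral)
    ultimately show ?case
      using elim by (auto simp: indicator_def ennreal_mult)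
  qed
  also have "\<dots> = ennreal (2 powr (1 - s)) * gauss_powr_tail s r"
    unfolding gauss_powr_tail_def using s by (rule nn_integral_powr_sqrt) measurable
  finally show ?thesis .
qed

lemma gauss_powr_tail_0:
  assumes s: "0 < s"
  shows "gauss_powr_tail s 0 = ennreal (2 powr (s - 1) * Gamma s)"
proof -
  have "ennreal (2 powr (1 - s)) * gauss_powr_tail s 0 =
      (\<integral>\<^sup>+u. ennreal (u powr (s - 1) / exp u) * indicator {0..} u \<partial>lborel)"
    using gauss_powr_tail_eq_upper_Gamma [OF s, of 0] by (simp add: exp_minus flip: divide_inverse)
  also have "\<dots> = ennreal (Gamma s)"
    by (rule nn_integral_has_integral_lebesgue' [OF _ Gamma_integral_real [OF s]]) simp
  finally have "ennreal (2 powr (s - 1)) * (ennreal (2 powr (1 - s)) * gauss_powr_tail s 0) =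
      ennreal (2 powr (s - 1)) * ennreal (Gamma s)" by simp
  moreover have "ennreal (2 powr (s - 1)) * ennreal (2 powr (1 - s)) = 1"
    by (simp add: ennreal_mult [symmetric] powr_add [symmetric])
  ultimately show ?thesis
    using s by (simp add: mult.assoc [symmetric] ennreal_mult Gamma_real_pos less_imp_le)
qed

text \<open>One radial constant \<open>C\<close> serves all thresholds, so it can be eliminated by
  comparison with threshold 0, where the left integral is the full moment and the tail is a Gamma
  value. Stating the result multiplied out avoids division in \<open>ennreal\<close>.\<close>

lemma nn_integral_gaussian_inner_power_tail:
  fixes a :: "real ^ 'k" and j :: nat
  defines "s \<equiv> real j + real CARD('k) / 2"
  shows "(\<integral>\<^sup>+x. ennreal (iso_gaussian_density 1 x * (a \<bullet> x) ^ (2 * j) * indicator {r<..} (norm x)) \<partial>lborel) *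
      ennreal (2 powr (s - 1) * Gamma s) =
    ennreal (norm a ^ (2 * j) * (fact (2 * j) / (2 ^ j * fact j))) * gauss_powr_tail s r"
proof -
  \<comment> \<open>The normalising constant of the standard Gaussian goes into the homogeneous
    part, so that the radial factor is just the exponential and the indicator.\<close>
  define w where "w = (sqrt (2 * pi)) ^ CARD('k)"
  have w: "0 < w" by (simp add: w_def)
  have s: "0 < s" by (simp add: s_def add_nonneg_pos)
  obtain C where C: "0 \<le> C" and radial:
    "\<And>\<phi>. \<phi> \<in> borel_measurable borel \<Longrightarrow> (\<integral>\<^sup>+x. ennreal ((a \<bullet> x) ^ (2 * j) / w) * \<phi> (norm x) \<partial>lborel) =
       ennreal C * (\<integral>\<^sup>+x. ennreal (x powr (real (2 * j + DIM(real ^ 'k)) - 1)) * indicator {0..} x * \<phi> x \<partial>lborel)"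
  proof (rule nn_integral_homogeneous_radial [where h = "\<lambda>x. (a \<bullet> x) ^ (2 * j) / w" and p = "2 * j"
        and B = "norm a ^ (2 * j) / w"])
    fix x :: "real ^ 'k" assume x: "norm x \<le> 1"
    have "\<bar>a \<bullet> x\<bar> \<le> norm a"
      using Cauchy_Schwarz_ineq2 [of a x] mult_left_mono [OF x norm_ge_zero [of a]] by simp
    then have "\<bar>a \<bullet> x\<bar> ^ (2 * j) \<le> norm a ^ (2 * j)"
      by (rule power_mono) simp
    then show "(a \<bullet> x) ^ (2 * j) / w \<le> norm a ^ (2 * j) / w"
      using w by (simp add: power_even_abs divide_right_mono)
  qed (use w in \<open>auto simp: power_mult_distrib\<close>)
  have tail: "(\<integral>\<^sup>+x. ennreal (iso_gaussian_density 1 x * (a \<bullet> x) ^ (2 * j) * indicator {t<..} (norm x)) \<partial>lborel) =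
      ennreal C * gauss_powr_tail s t" for t
  proof -
    have "(\<integral>\<^sup>+x. ennreal (iso_gaussian_density 1 x * (a \<bullet> x) ^ (2 * j) * indicator {t<..} (norm x)) \<partial>lborel) =
        (\<integral>\<^sup>+x. ennreal ((a \<bullet> x) ^ (2 * j) / w) * ennreal (exp (- (norm x)\<^sup>2 / 2) * indicator {t<..} (norm x)) \<partial>lborel)"
      using w by (intro nn_integral_cong)
        (simp add: iso_gaussian_density_def w_def ennreal_mult [symmetric])
    also have "\<dots> = ennreal C * gauss_powr_tail s t"
      by (subst radial) (simp_all add: gauss_powr_tail_def s_def algebra_simps)
    finally show ?thesis .
  qed
  have "ennreal C * ennreal (2 powr (s - 1) * Gamma s) =
      (\<integral>\<^sup>+x. ennreal (iso_gaussian_density 1 x * (a \<bullet> x) ^ (2 * j) * indicator {0<..} (norm x)) \<partial>lborel)"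
    by (simp add: tail gauss_powr_tail_0 s)
  also have "\<dots> = (\<integral>\<^sup>+x. ennreal (iso_gaussian_density 1 x * (a \<bullet> x) ^ (2 * j)) \<partial>lborel)"
    using AE_lborel_singleton [of "0 :: real ^ 'k"]
    by (intro nn_integral_cong_AE, eventually_elim) (simp add: indicator_def)
  also have "\<dots> = ennreal (norm a ^ (2 * j) * (fact (2 * j) / (2 ^ j * fact j)))"
    by (rule nn_integral_gaussian_inner_moment)
  finally show ?thesis
    unfolding tail by (metis mult.assoc mult.commute)
qed

subsection \<open>The tail of a shifted Gaussian vector\<close>

lemma nn_integral_lborel_uminus:
  fixes g :: "'a::euclidean_space \<Rightarrow> ennreal"
  assumes [measurable]: "g \<in> borel_measurable borel"
  shows "(\<integral>\<^sup>+x. g (- x) \<partial>lborel) = (\<integral>\<^sup>+x. g x \<partial>lborel)"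
proof -
  have "surj (uminus :: 'a \<Rightarrow> 'a)" by (metis surjI minus_minus)
  then have "distr lborel borel (uminus :: 'a \<Rightarrow> 'a) = lborel"
    by (intro distr_lborel_isometry) (auto intro: linearI)
  then have "(\<integral>\<^sup>+x. g x \<partial>lborel) = (\<integral>\<^sup>+x. g x \<partial>distr lborel borel uminus)" by simp
  also have "\<dots> = (\<integral>\<^sup>+x. g (- x) \<partial>lborel)"
    by (subst nn_integral_distr) simp_all
  finally show ?thesis ..
qed

lemma iso_gaussian_density_shift:
  "iso_gaussian_density 1 (x - a) =
    exp (- (norm a)\<^sup>2 / 2) * iso_gaussian_density 1 x * exp (a \<bullet> x)"
proof -
  have "- (norm (x - a))\<^sup>2 / 2 = - (norm a)\<^sup>2 / 2 + - (norm x)\<^sup>2 / 2 + a \<bullet> x"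
    by (simp add: power2_norm_eq_inner inner_diff_left inner_diff_right inner_commute field_simps)
  then show ?thesis
    by (simp add: iso_gaussian_density_def flip: exp_add)
qed

text \<open>Averaging over x and -x replaces the exponential by cosh. All terms of the cosh series
  are nonnegative, so sum and integral may be exchanged without any integrability argument.\<close>

lemma nn_integral_shifted_gaussian_tail:
  fixes a :: "'a::euclidean_space"
  shows "(\<integral>\<^sup>+x. ennreal (iso_gaussian_density 1 (x - a) * indicator {r<..} (norm x)) \<partial>lborel) =
    (\<Sum>j. ennreal (exp (- (norm a)\<^sup>2 / 2) / fact (2 * j)) *
      (\<integral>\<^sup>+x. ennreal (iso_gaussian_density 1 x * (a \<bullet> x) ^ (2 * j) * indicator {r<..} (norm x)) \<partial>lborel))"
proof -
  define F where "F x = exp (- (norm a)\<^sup>2 / 2) * iso_gaussian_density 1 x * indicator {r<..} (norm x)"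
    for x :: 'a
  have [measurable]: "F \<in> borel_measurable borel"
    unfolding F_def by measurable
  have F: "0 \<le> F x" "F (- x) = F x" for x
    by (auto simp: F_def iso_gaussian_density_nonneg, simp add: iso_gaussian_density_def)
  define I where "I = (\<integral>\<^sup>+x. ennreal (F x * exp (a \<bullet> x)) \<partial>lborel)"
  have "I = (\<integral>\<^sup>+x. ennreal (F x * exp (- (a \<bullet> x))) \<partial>lborel)"
    unfolding I_def
    by (subst nn_integral_lborel_uminus [symmetric]) (simp_all add: F)
  \<comment> \<open>\<open>F\<close> is even, so reflection gives a second expression for
    \<open>I\<close>; adding the two produces 2 cosh, and the finite nonzero factor 2
    cancels.\<close>
  then have "2 * I = (\<integral>\<^sup>+x. ennreal (F x * exp (a \<bullet> x)) \<partial>lborel) +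
      (\<integral>\<^sup>+x. ennreal (F x * exp (- (a \<bullet> x))) \<partial>lborel)"
    by (metis I_def mult_2)
  also have "\<dots> = (\<integral>\<^sup>+x. ennreal (F x * exp (a \<bullet> x)) + ennreal (F x * exp (- (a \<bullet> x))) \<partial>lborel)"
    by (rule nn_integral_add [symmetric]) measurable
  also have "\<dots> = (\<integral>\<^sup>+x. 2 * ennreal (F x * cosh (a \<bullet> x)) \<partial>lborel)"
  proof (rule nn_integral_cong)
    fix x
    have "F x * exp (a \<bullet> x) + F x * exp (- (a \<bullet> x)) = 2 * (F x * cosh (a \<bullet> x))"
      by (simp add: cosh_field_def algebra_simps)
    then show "ennreal (F x * exp (a \<bullet> x)) + ennreal (F x * exp (- (a \<bullet> x))) =
        2 * ennreal (F x * cosh (a \<bullet> x))"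
      using F(1) [of x] by (simp flip: ennreal_plus) (simp add: ennreal_mult')
  qed
  also have "\<dots> = 2 * (\<integral>\<^sup>+x. ennreal (F x * cosh (a \<bullet> x)) \<partial>lborel)"
    unfolding cosh_field_def by (rule nn_integral_cmult) measurable
  finally have "I = (\<integral>\<^sup>+x. ennreal (F x * cosh (a \<bullet> x)) \<partial>lborel)"
    by (simp add: ennreal_mult_cancel_left)
  also have "\<dots> = (\<integral>\<^sup>+x. (\<Sum>j. ennreal (F x * ((a \<bullet> x) ^ (2 * j) / fact (2 * j)))) \<partial>lborel)"
    by (intro nn_integral_cong suminf_ennreal_eq [symmetric] sums_mult cosh_sums) (simp add: F)
  also have "\<dots> = (\<Sum>j. \<integral>\<^sup>+x. ennreal (F x * ((a \<bullet> x) ^ (2 * j) / fact (2 * j))) \<partial>lborel)"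
    by (rule nn_integral_suminf) measurable
  also have "\<dots> = (\<Sum>j. ennreal (exp (- (norm a)\<^sup>2 / 2) / fact (2 * j)) *
      (\<integral>\<^sup>+x. ennreal (iso_gaussian_density 1 x * (a \<bullet> x) ^ (2 * j) * indicator {r<..} (norm x)) \<partial>lborel))"
  proof (rule suminf_cong)
    fix j
    have "ennreal (F x * ((a \<bullet> x) ^ (2 * j) / fact (2 * j))) =
        ennreal (exp (- (norm a)\<^sup>2 / 2) / fact (2 * j)) *
        ennreal (iso_gaussian_density 1 x * (a \<bullet> x) ^ (2 * j) * indicator {r<..} (norm x))" for x
      by (subst ennreal_mult' [symmetric]) (simp_all add: F_def mult_ac)
    then show "(\<integral>\<^sup>+x. ennreal (F x * ((a \<bullet> x) ^ (2 * j) / fact (2 * j))) \<partial>lborel) =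
        ennreal (exp (- (norm a)\<^sup>2 / 2) / fact (2 * j)) *
        (\<integral>\<^sup>+x. ennreal (iso_gaussian_density 1 x * (a \<bullet> x) ^ (2 * j) * indicator {r<..} (norm x)) \<partial>lborel)"
      by (simp add: nn_integral_cmult)
  qed
  finally show ?thesis
    by (simp add: I_def F_def iso_gaussian_density_shift mult_ac)
qed

text \<open>The Poisson weight of j with mean \<open>\<alpha>\<^sup>2 / 2\<close>, divided by the
  normalising constant of the chi density with 2 (j + k) degrees of freedom. Multiplied by the
  matching tails these sum to the noncentral chi tail.\<close>

definition chi_coeff :: "real \<Rightarrow> real \<Rightarrow> nat \<Rightarrow> real" where
  "chi_coeff k \<alpha> j = exp (- \<alpha>\<^sup>2 / 2) * \<alpha> ^ (2 * j) /
     (2 ^ j * fact j * (2 powr (real j + k - 1) * Gamma (real j + k)))"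

lemma chi_coeff_nonneg: "0 < k \<Longrightarrow> 0 \<le> chi_coeff k \<alpha> j"
  unfolding chi_coeff_def
  by (intro divide_nonneg_nonneg mult_nonneg_nonneg less_imp_le [OF Gamma_real_pos]) auto

lemma nn_integral_shifted_gaussian_tail_chi:
  fixes a :: "real ^ 'k"
  shows "(\<integral>\<^sup>+x. ennreal (iso_gaussian_density 1 (x - a) * indicator {r<..} (norm x)) \<partial>lborel) =
    (\<Sum>j. ennreal (chi_coeff (real CARD('k) / 2) (norm a) j) * gauss_powr_tail (real j + real CARD('k) / 2) r)"
  unfolding nn_integral_shifted_gaussian_tail
proof (rule suminf_cong)
  fix j
  define s where "s = real j + real CARD('k) / 2"
  define T where "T = (\<integral>\<^sup>+x. ennreal (iso_gaussian_density 1 x * (a \<bullet> x) ^ (2 * j) *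
    indicator {r<..} (norm x)) \<partial>lborel)"
  define D where "D = 2 powr (s - 1) * Gamma s"
  define m where "m = norm a ^ (2 * j) * (fact (2 * j) / (2 ^ j * fact j))"
  have D: "0 < D"
    unfolding D_def s_def by (intro mult_pos_pos Gamma_real_pos add_nonneg_pos) auto
  have m: "0 \<le> m" by (simp add: m_def)
  have "T * ennreal D = ennreal m * gauss_powr_tail s r"
    unfolding T_def D_def m_def s_def by (rule nn_integral_gaussian_inner_power_tail)
  then have "T * (ennreal D * ennreal (1 / D)) = ennreal m * ennreal (1 / D) * gauss_powr_tail s r"
    by (metis mult.assoc mult.commute)
  then have T: "T = ennreal (m / D) * gauss_powr_tail s r"
    using D m by (simp add: ennreal_mult [symmetric])
  \<comment> \<open>The factorial of 2 j from the cosh series cancels against the one in the even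
    moment, leaving the Poisson weight.\<close>
  have "exp (- (norm a)\<^sup>2 / 2) / fact (2 * j) * (m / D) = chi_coeff (real CARD('k) / 2) (norm a) j"
    unfolding chi_coeff_def s_def [symmetric] D_def [symmetric] m_def
    by (simp add: field_simps)
  then show "ennreal (exp (- (norm a)\<^sup>2 / 2) / fact (2 * j)) *
      (\<integral>\<^sup>+x. ennreal (iso_gaussian_density 1 x * (a \<bullet> x) ^ (2 * j) * indicator {r<..} (norm x)) \<partial>lborel) =
    ennreal (chi_coeff (real CARD('k) / 2) (norm a) j) * gauss_powr_tail (real j + real CARD('k) / 2) r"
    using D m unfolding T_def [symmetric] T s_def [symmetric]
    by (simp add: mult.assoc [symmetric] ennreal_mult [symmetric])
qed

section \<open>The Marcum Q-function as a series of chi tails\<close>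

lemma marcum_Q_zero:
  assumes k: "0 < k" and r: "0 \<le> r"
  shows "marcum_Q k 0 r = enn2real (\<Sum>j. ennreal (chi_coeff k 0 j) * gauss_powr_tail (real j + k) r)"
proof -
  have G: "0 < Gamma k" using k by (rule Gamma_real_pos)
  have "upper_Gamma k (r\<^sup>2 / 2) =
      enn2real (\<integral>\<^sup>+u. ennreal (u powr (k - 1) * exp (- u)) * indicator {r\<^sup>2 / 2..} u \<partial>lborel)"
    unfolding upper_Gamma_def set_lebesgue_integral_def
    by (subst integral_eq_nn_integral)
      (auto intro!: arg_cong [where f = enn2real] nn_integral_cong simp: indicator_def)
  also have "\<dots> = 2 powr (1 - k) * enn2real (gauss_powr_tail k r)"
    by (simp add: gauss_powr_tail_eq_upper_Gamma k r enn2real_mult)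
  finally have "marcum_Q k 0 r = enn2real (gauss_powr_tail k r) / (2 powr (k - 1) * Gamma k)"
    by (simp add: marcum_Q_def powr_diff divide_simps)
  \<comment> \<open>At \<open>\<alpha> = 0\<close> the factor \<open>\<alpha> ^ (2 * j)\<close>
    vanishes except for j = 0, where it is 1.\<close>
  moreover have "(\<Sum>j. ennreal (chi_coeff k 0 j) * gauss_powr_tail (real j + k) r) =
      (\<Sum>j\<in>{0}. ennreal (chi_coeff k 0 j) * gauss_powr_tail (real j + k) r)"
    by (rule suminf_finite) (auto simp: chi_coeff_def power_0_left)
  ultimately show ?thesis
    using G by (simp add: chi_coeff_def enn2real_mult)
qed

text \<open>The Bessel series is integrated term by term in \<open>ennreal\<close>. Its convergence
  is not proved separately: \<open>fin\<close> says that the integrated sum is finite, which yields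
  summability almost everywhere. In the application the sum is a probability.\<close>

lemma marcum_Q_pos:
  assumes k: "0 < k" and \<alpha>: "0 < \<alpha>" and r: "0 \<le> r"
    and fin: "(\<Sum>j. ennreal (chi_coeff k \<alpha> j) * gauss_powr_tail (real j + k) r) < \<infinity>"
  shows "marcum_Q k \<alpha> r = enn2real (\<Sum>j. ennreal (chi_coeff k \<alpha> j) * gauss_powr_tail (real j + k) r)"
proof -
  define b where "b j x = (if \<alpha> * x = 0 \<and> 2 * real j + (k - 1) = 0 then 1
      else (\<alpha> * x / 2) powr (2 * real j + (k - 1))) / (fact j * Gamma (k - 1 + real j + 1))" for j x
  define K where "K x = 1 / \<alpha> powr (k - 1) * (indicator {r..} x * (x powr k * exp (- (x\<^sup>2 + \<alpha>\<^sup>2) / 2)))" for x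
  have bessel: "bessel_I (k - 1) (\<alpha> * x) = (\<Sum>j. b j x)" for x
    by (simp add: bessel_I_def b_def)
  have [measurable]: "b j \<in> borel_measurable borel" "K \<in> borel_measurable borel" for j
    unfolding b_def K_def by measurable
  have Gpos: "0 < Gamma (k - 1 + real j + 1)" for j
    using k by (intro Gamma_real_pos) simp
  have b_nonneg: "0 \<le> b j x" for j x
    using Gpos [of j] by (simp add: b_def less_imp_le)
  have K_nonneg: "0 \<le> K x" for x
    by (simp add: K_def indicator_def)
  \<comment> \<open>The point r is excluded because \<open>K\<close> uses the closed half-line and
    the tail the open one.\<close>
  have term_eq: "ennreal (K x * b j x) = ennreal (chi_coeff k \<alpha> j) *
      (ennreal (x powr (2 * (real j + k) - 1)) * indicator {0..} x * ennreal (exp (- x\<^sup>2 / 2) * indicator {r<..} x))"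
    if x: "x \<noteq> 0" "x \<noteq> r" for x j
  proof (cases "r < x")
    case True
    then have x0: "0 < x" using r by simp
    have e: "exp (- (x\<^sup>2 + \<alpha>\<^sup>2) / 2) = exp (- \<alpha>\<^sup>2 / 2) * exp (- x\<^sup>2 / 2)"
      by (simp add: exp_add [symmetric] diff_divide_distrib)
    \<comment> \<open>The exponent of 2 splits as j + (j + k - 1): the first part belongs to the
      Poisson weight, the second to the chi normalisation.\<close>
    have p: "(\<alpha> * x / 2) powr (2 * real j + (k - 1)) =
        \<alpha> ^ (2 * j) * \<alpha> powr (k - 1) * x powr (2 * real j + (k - 1)) / (2 ^ j * 2 powr (real j + k - 1))"
    proof -
      have "(2 :: real) ^ j * 2 powr (real j + k - 1) = 2 powr (2 * real j + (k - 1))"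
        by (simp add: powr_realpow [symmetric] powr_add [symmetric] algebra_simps)
      moreover have "\<alpha> ^ (2 * j) * \<alpha> powr (k - 1) = \<alpha> powr (2 * real j + (k - 1))"
        using \<alpha> by (simp add: powr_realpow [symmetric] powr_add [symmetric])
      ultimately show ?thesis
        using \<alpha> x0 by (simp add: powr_divide powr_mult)
    qed
    have xx: "x powr k * x powr (2 * real j + (k - 1)) = x powr (2 * (real j + k) - 1)"
      by (simp add: powr_add [symmetric] algebra_simps)
    have "K x * b j x = (x powr k * x powr (2 * real j + (k - 1))) * exp (- \<alpha>\<^sup>2 / 2) * exp (- x\<^sup>2 / 2) *
        (\<alpha> ^ (2 * j) / (2 ^ j * 2 powr (real j + k - 1) * (fact j * Gamma (real j + k))))"
      using x0 \<alpha> True unfolding K_def b_def p e by (simp add: add.commute)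
    also have "\<dots> = chi_coeff k \<alpha> j * (x powr (2 * (real j + k) - 1) * exp (- x\<^sup>2 / 2))"
      unfolding xx by (simp add: chi_coeff_def mult_ac)
    finally show ?thesis
      using x0 True by (simp add: ennreal_mult chi_coeff_nonneg k)
  next
    case False
    then show ?thesis using x by (simp add: K_def)
  qed
  have AE_ne: "AE x in lborel. x \<noteq> 0 \<and> x \<noteq> r"
    using AE_lborel_singleton [of 0] AE_lborel_singleton [of r] by eventually_elim simp
  have "(\<integral>\<^sup>+x. ennreal (K x * b j x) \<partial>lborel) = ennreal (chi_coeff k \<alpha> j) * gauss_powr_tail (real j + k) r" for j
  proof -
    have "(\<integral>\<^sup>+x. ennreal (K x * b j x) \<partial>lborel) = (\<integral>\<^sup>+x. ennreal (chi_coeff k \<alpha> j) *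
      (ennreal (x powr (2 * (real j + k) - 1)) * indicator {0..} x * ennreal (exp (- x\<^sup>2 / 2) * indicator {r<..} x)) \<partial>lborel)"
      using AE_ne by (intro nn_integral_cong_AE, eventually_elim) (rule term_eq; simp)
    then show ?thesis
      unfolding gauss_powr_tail_def by (simp add: nn_integral_cmult)
  qed
  then have sum_eq: "(\<Sum>j. ennreal (chi_coeff k \<alpha> j) * gauss_powr_tail (real j + k) r) =
      (\<integral>\<^sup>+x. (\<Sum>j. ennreal (K x * b j x)) \<partial>lborel)"
    by (subst nn_integral_suminf) simp_all
  with fin have "AE x in lborel. (\<Sum>j. ennreal (K x * b j x)) \<noteq> \<infinity>"
    by (intro nn_integral_PInf_AE) auto
  then have AE_eq: "AE x in lborel. 0 \<le> K x * bessel_I (k - 1) (\<alpha> * x) \<and>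
      (\<Sum>j. ennreal (K x * b j x)) = ennreal (K x * bessel_I (k - 1) (\<alpha> * x))"
  proof eventually_elim
    case (elim x)
    then have summ: "summable (\<lambda>j. K x * b j x)"
      using K_nonneg b_nonneg by (intro summable_suminf_not_top) auto
    have eq: "(\<Sum>j. K x * b j x) = K x * bessel_I (k - 1) (\<alpha> * x)"
    \<comment> \<open>Where \<open>K\<close> vanishes both sides are 0 whatever the Bessel series
      does; elsewhere summability of the products gives that of the series itself.\<close>
    proof (cases "K x = 0")
      case False
      with summ have "summable (\<lambda>j. b j x)" by simp
      then show ?thesis by (simp add: bessel suminf_mult)
    qed simp
    show ?case
      using summ K_nonneg b_nonneg unfolding eq [symmetric]
      by (auto simp: suminf_ennreal2 intro!: suminf_nonneg)
  qed
  have bessel_meas [measurable]: "(\<lambda>x. bessel_I (k - 1) (\<alpha> * x)) \<in> borel_measurable borel"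
    unfolding bessel by measurable
  have "marcum_Q k \<alpha> r = (\<integral>x. K x * bessel_I (k - 1) (\<alpha> * x) \<partial>lborel)"
    using \<alpha> unfolding marcum_Q_def set_lebesgue_integral_def K_def
    by (simp add: mult.assoc flip: integral_mult_right_zero)
  also have "\<dots> = enn2real (\<integral>\<^sup>+x. ennreal (K x * bessel_I (k - 1) (\<alpha> * x)) \<partial>lborel)"
  proof (rule integral_eq_nn_integral)
    show "AE x in lborel. 0 \<le> K x * bessel_I (k - 1) (\<alpha> * x)"
      using AE_eq by eventually_elim simp
  qed measurable
  also have "(\<integral>\<^sup>+x. ennreal (K x * bessel_I (k - 1) (\<alpha> * x)) \<partial>lborel) =
      (\<integral>\<^sup>+x. (\<Sum>j. ennreal (K x * b j x)) \<partial>lborel)"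
    using AE_eq by (intro nn_integral_cong_AE) auto
  finally show ?thesis by (simp only: sum_eq)
qed

lemma marcum_Q_eq_chi_mixture:
  assumes "0 < k" "0 \<le> \<alpha>" "0 \<le> r"
    and "(\<Sum>j. ennreal (chi_coeff k \<alpha> j) * gauss_powr_tail (real j + k) r) < \<infinity>"
  shows "marcum_Q k \<alpha> r = enn2real (\<Sum>j. ennreal (chi_coeff k \<alpha> j) * gauss_powr_tail (real j + k) r)"
  using assms marcum_Q_zero marcum_Q_pos by (cases "\<alpha> = 0") auto

lemma measure_shifted_gaussian_norm_gt:
  fixes Z :: "'w \<Rightarrow> real ^ 'k"
  assumes \<sigma>: "0 < \<sigma>" and M: "prob_space M" and r: "0 \<le> r"
    and Z: "distributed M lborel Z (\<lambda>z. ennreal (iso_gaussian_density \<sigma> z))"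
  shows "measure M {\<omega> \<in> space M. norm (a + Z \<omega>) > r} =
    marcum_Q (real CARD('k) / 2) (norm a / \<sigma>) (r / \<sigma>)"
proof -
  interpret prob_space M by fact
  have [measurable]: "Z \<in> borel_measurable M"
    using distributed_measurable [OF Z] by simp
  let ?A = "{\<omega> \<in> space M. norm (a + Z \<omega>) > r}"
  have "emeasure M ?A = emeasure M (Z -` {z. norm (a + z) > r} \<inter> space M)"
    by (rule arg_cong [where f = "emeasure M"]) auto
  also have "\<dots> = (\<integral>\<^sup>+z. ennreal (iso_gaussian_density \<sigma> z) * indicator {z. norm (a + z) > r} z \<partial>lborel)"
    by (rule distributed_emeasure [OF Z]) measurable
  also have "\<dots> = (\<integral>\<^sup>+z. ennreal (iso_gaussian_density \<sigma> z * indicator {r<..} (norm (a + z))) \<partial>lborel)"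
    by (intro nn_integral_cong) (simp add: indicator_def)
  \<comment> \<open>Substituting \<open>z = - a + \<sigma> *\<^sub>R x\<close> turns
    \<open>a + z\<close> into a multiple of x, moving the shift into the density, while the Jacobian
    rescales that density to variance one.\<close>
  also have "\<dots> = (\<integral>\<^sup>+z. ennreal (iso_gaussian_density \<sigma> z * indicator {r<..} (norm (a + z)))
      \<partial>density (distr lborel borel (\<lambda>x. - a + \<sigma> *\<^sub>R x)) (\<lambda>_. \<bar>\<sigma>\<bar> ^ DIM(real ^ 'k)))"
    using \<sigma> by (subst lborel_affine [of \<sigma> "- a"]) simp_all
  also have "\<dots> = (\<integral>\<^sup>+x. ennreal (\<sigma> ^ CARD('k)) *
      ennreal (iso_gaussian_density \<sigma> (\<sigma> *\<^sub>R x - a) * indicator {r<..} (norm (\<sigma> *\<^sub>R x))) \<partial>lborel)"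
    using \<sigma> by (simp add: nn_integral_density nn_integral_distr)
  also have "\<dots> = (\<integral>\<^sup>+x. ennreal (iso_gaussian_density 1 (x - a /\<^sub>R \<sigma>) * indicator {r / \<sigma><..} (norm x)) \<partial>lborel)"
  proof (rule nn_integral_cong)
    fix x :: "real ^ 'k"
    have "\<sigma> *\<^sub>R x - a = \<sigma> *\<^sub>R (x - a /\<^sub>R \<sigma>)"
      using \<sigma> by (simp add: scaleR_diff_right)
    then have "\<sigma> ^ CARD('k) * iso_gaussian_density \<sigma> (\<sigma> *\<^sub>R x - a) = iso_gaussian_density 1 (x - a /\<^sub>R \<sigma>)"
      using \<sigma> by (simp add: iso_gaussian_density_def real_sqrt_mult power_mult_distrib)
    moreover have "indicator {r<..} (norm (\<sigma> *\<^sub>R x)) = (indicator {r / \<sigma><..} (norm x) :: real)"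
      using \<sigma> by (simp add: indicator_def divide_less_eq mult.commute)
    ultimately show "ennreal (\<sigma> ^ CARD('k)) *
        ennreal (iso_gaussian_density \<sigma> (\<sigma> *\<^sub>R x - a) * indicator {r<..} (norm (\<sigma> *\<^sub>R x))) =
        ennreal (iso_gaussian_density 1 (x - a /\<^sub>R \<sigma>) * indicator {r / \<sigma><..} (norm x))"
      using \<sigma> by (simp add: ennreal_mult' [symmetric] mult.assoc [symmetric])
  qed
  also have "\<dots> = (\<Sum>j. ennreal (chi_coeff (real CARD('k) / 2) (norm a / \<sigma>) j) *
      gauss_powr_tail (real j + real CARD('k) / 2) (r / \<sigma>))"
  proof -
    have "norm (a /\<^sub>R \<sigma>) = norm a / \<sigma>"
      using \<sigma> by (simp add: divide_inverse_commute)
    then show ?thesis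
      by (simp only: nn_integral_shifted_gaussian_tail_chi)
  qed
  finally have P: "emeasure M ?A = (\<Sum>j. ennreal (chi_coeff (real CARD('k) / 2) (norm a / \<sigma>) j) *
      gauss_powr_tail (real j + real CARD('k) / 2) (r / \<sigma>))" .
  \<comment> \<open>The finiteness required here holds because the series equals the measure of an
    event.\<close>
  have "marcum_Q (real CARD('k) / 2) (norm a / \<sigma>) (r / \<sigma>) = enn2real (emeasure M ?A)"
    unfolding P by (rule marcum_Q_eq_chi_mixture) (use \<sigma> r in \<open>auto simp: P [symmetric] less_top [symmetric]\<close>)
  then show ?thesis by (simp add: measure_def)
qed

section \<open>The projection identity and the final reduction\<close>

lemma orthonormal_columns_mult_transpose:
  fixes Q :: "real ^ 'n ^ 'm" and N :: "real ^ 'k ^ 'm"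
  assumes Q: "orthonormal_columns Q" and N: "orthonormal_columns N"
    and range: "span (columns N) = range (\<lambda>v. col_proj_perp Q *v v)"
  shows "N ** transpose N = col_proj_perp Q"
proof -
  have perp: "col_proj_perp Q *v y = y - Q *v (transpose Q *v y)" for y
    by (simp add: col_proj_perp_def col_proj_def matrix_vector_mult_diff_rdistrib
        matrix_vector_mul_assoc del: transpose_matrix_vector)
  have orth: "(N *v u) \<bullet> (Q *v w) = 0" for u w
  proof -
    obtain v where v: "N *v u = col_proj_perp Q *v v"
      using range matrix_vector_mult_in_columnspace [of N u] by auto
    have "transpose Q *v (N *v u) = 0"
      by (simp add: v perp matrix_vector_mult_diff_distrib orthonormal_columns_left_inverse [OF Q]
          del: transpose_matrix_vector)
    then show ?thesis
      by (metis dot_lmul_matrix inner_zero_left transpose_matrix_vector)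
  qed
  have NQ: "transpose N *v (Q *v w) = 0" for w
  proof -
    have "(transpose N *v (Q *v w)) \<bullet> (transpose N *v (Q *v w)) =
        (N *v (transpose N *v (Q *v w))) \<bullet> (Q *v w)"
      by (metis dot_lmul_matrix inner_commute transpose_matrix_vector)
    then show ?thesis by (simp add: orth del: transpose_matrix_vector)
  qed
  have "N *v (transpose N *v y) = col_proj_perp Q *v y" for y
  proof -
    have "col_proj_perp Q *v y \<in> range ((*v) N)"
    proof -
      have "columns N \<subseteq> range ((*v) N)"
        by (auto simp: columns_def matrix_vector_mult_basis [symmetric])
      moreover have "subspace (range ((*v) N))"
        by (intro linear_subspace_image) auto
      ultimately have "span (columns N) \<subseteq> range ((*v) N)"
        by (rule span_minimal)
      then show ?thesis using range by auto
    qed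
    then obtain u where u: "col_proj_perp Q *v y = N *v u" by auto
    \<comment> \<open>This splits y into parts in the ranges of \<open>N\<close> and
      \<open>Q\<close>. Applying \<open>transpose N\<close> kills the second and recovers the
      coordinates \<open>u\<close> of the first.\<close>
    then have "y = N *v u + Q *v (transpose Q *v y)"
      by (simp add: perp algebra_simps del: transpose_matrix_vector)
    then have "transpose N *v y = u"
      by (metis NQ N add.right_neutral matrix_vector_right_distrib orthonormal_columns_left_inverse)
    then show ?thesis by (simp add: u)
  qed
  then show ?thesis
    by (simp add: matrix_eq matrix_vector_mul_assoc del: transpose_matrix_vector)
qed

theorem proposition5p1:
  fixes M :: "'w measure"
    and Q :: "real ^ 'n ^ 'm"
    and N :: "real ^ 'k ^ 'm"
    and X :: "real ^ 'm"
    and Y :: "'w \<Rightarrow> real ^ 'm"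
    and \<sigma> :: real
  assumes "CARD('m) > CARD('n)"
    and "CARD('k) = CARD('m) - CARD('n)"
    and "orthonormal_columns Q"
    and "orthonormal_columns N"
    and "span (columns N) = range (\<lambda>v. col_proj_perp Q *v v)"
    and "X \<in> range (\<lambda>v. col_proj_perp Q *v v)"
    and "\<sigma> > 0"
    and "prob_space M"
    and "distributed M lborel Y (\<lambda>y. ennreal (iso_gaussian_density \<sigma> y))"
  shows "N ** transpose N = col_proj_perp Q \<and>
         distributed M lborel (\<lambda>\<omega>. transpose N *v Y \<omega>)
           (\<lambda>z. ennreal (iso_gaussian_density \<sigma> z)) \<and>
         (\<forall>\<epsilon>\<ge>0. measure M {\<omega> \<in> space M. norm (X + col_proj_perp Q *v Y \<omega>) > \<epsilon>} =
           marcum_Q (real (CARD('m) - CARD('n)) / 2) (norm X / \<sigma>) (\<epsilon> / \<sigma>))"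
proof (intro conjI allI impI)
  show NNT: "N ** transpose N = col_proj_perp Q"
    using assms(3-5) by (rule orthonormal_columns_mult_transpose)
  have "CARD('k) + CARD('n) = CARD('m)"
    using assms(1,2) by simp
  from distributed_gaussian_orthonormal [OF this assms(3,4) NNT assms(7-9)]
  show Z: "distributed M lborel (\<lambda>\<omega>. transpose N *v Y \<omega>) (\<lambda>z. ennreal (iso_gaussian_density \<sigma> z))" .
  have perp: "col_proj_perp Q *v y = N *v (transpose N *v y)" for y
    by (simp add: NNT [symmetric] matrix_vector_mul_assoc del: transpose_matrix_vector)
  obtain x where X: "X = N *v x"
    using assms(6) perp by auto
  fix \<epsilon> :: real assume "0 \<le> \<epsilon>"
  \<comment> \<open>Both summands lie in the range of \<open>N\<close>, so \<open>N\<close> factors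
    out and, being an isometry, leaves a norm in the smaller space.\<close>
  have "norm (X + col_proj_perp Q *v y) = norm (x + transpose N *v y)" for y
    by (simp add: X perp norm_orthonormal_columns [OF assms(4)] del: transpose_matrix_vector
        flip: matrix_vector_right_distrib)
  moreover have "norm X = norm x"
    by (simp add: X norm_orthonormal_columns [OF assms(4)])
  ultimately show "measure M {\<omega> \<in> space M. norm (X + col_proj_perp Q *v Y \<omega>) > \<epsilon>} =
      marcum_Q (real (CARD('m) - CARD('n)) / 2) (norm X / \<sigma>) (\<epsilon> / \<sigma>)"
    using measure_shifted_gaussian_norm_gt [OF assms(7,8) \<open>0 \<le> \<epsilon>\<close> Z, of x] assms(2) by simp
qed

end
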